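(* Let $n\ge 3$ and let $F_n^1$, $F_n^2$ be the complex Leibniz algebras with basis $\{e_1,\dots,e_n\}$ given by $$F_n^1:\ [e_1,e_1]=e_3,\quad [e_i,e_1]=e_{i+1},\ 2\le i\le n-1;\qquad F_n^2:\ [e_1,e_1]=e_3,\quad [e_i,e_1]=e_{i+1},\ 3\le i\le n-1.$$ For every $k\ge5$, every $k$-dimensional central extension of $F_n^1$ is split, and every $k$-dimensional central extension of $F_n^2$ is split.
   Context: All vector spaces and algebras are finite-dimensional over $\mathbb{C}$; in multiplication tables omitted products of basis elements are zero. A Leibniz algebra is an algebra $L$ with bilinear product satisfying $[x,[y,z]]=[[x,y],z]-[[x,z],y]$. A $k$-dimensional central extension of a Leibniz algebra $L$ is a Leibniz algebra $\widehat L$ fitting into a short exact sequence of Leibniz algebras $0\to V\to\widehat L\to L\to0$ with $\dim V=k$ and the image of $V$ contained in the center of $\widehat L$; equivalently $\widehat L\cong L\oplus V$ with product $[x+u,y+v]=[x,y]_L+\theta(x,y)$, where $\theta:L\times L\to V$ is bilinear with $\theta(x,[y,z])=\theta([x,y],z)-\theta([x,z],y)$. A $k$-dimensional central extension of $L$ is split if, as an algebra, it is isomorphic to $L'\oplus\mathbb{C}$, where $L'$ is a $(k-1)$-dimensional central extension of $L$ and $\mathbb{C}$ is the one-dimensional abelian algebra. *)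

theory Defs
  imports Complex_Main "HOL-Library.Function_Algebras" "HOL-Library.Product_Plus"
begin

text \<open>
  A complex algebra is carried by a subspace of an ambient complex vector space: addition is
  that of the ambient type, scalar multiplication and product are part of the structure.  Only
  the values of the product on the carrier matter.
\<close>

record 'a calgebra =
  carrier :: "'a set"
  smul :: "complex \<Rightarrow> 'a \<Rightarrow> 'a"
  bracket :: "'a \<Rightarrow> 'a \<Rightarrow> 'a"

locale complex_algebra =
  fixes L :: "'a::ab_group_add calgebra"
  assumes ambient: "vector_space (smul L)"
    and finite_dim: "\<exists>B. finite B \<and> carrier L = module.span (smul L) B"
    and closed: "\<lbrakk>x \<in> carrier L; y \<in> carrier L\<rbrakk> \<Longrightarrow> bracket L x y \<in> carrier L"
    and add_left: "\<lbrakk>x \<in> carrier L; y \<in> carrier L; z \<in> carrier L\<rbrakk> \<Longrightarrow>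
      bracket L (x + y) z = bracket L x z + bracket L y z"
    and add_right: "\<lbrakk>x \<in> carrier L; y \<in> carrier L; z \<in> carrier L\<rbrakk> \<Longrightarrow>
      bracket L x (y + z) = bracket L x y + bracket L x z"
    and smul_left: "\<lbrakk>x \<in> carrier L; y \<in> carrier L\<rbrakk> \<Longrightarrow>
      bracket L (smul L c x) y = smul L c (bracket L x y)"
    and smul_right: "\<lbrakk>x \<in> carrier L; y \<in> carrier L\<rbrakk> \<Longrightarrow>
      bracket L x (smul L c y) = smul L c (bracket L x y)"

locale leibniz_algebra = complex_algebra +
  assumes leibniz: "\<lbrakk>x \<in> carrier L; y \<in> carrier L; z \<in> carrier L\<rbrakk> \<Longrightarrow>
    bracket L x (bracket L y z) = bracket L (bracket L x y) z - bracket L (bracket L x z) y"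

definition dimension :: "'a::ab_group_add calgebra \<Rightarrow> nat" where
  "dimension L = vector_space.dim (smul L) (carrier L)"

definition center :: "'a::ab_group_add calgebra \<Rightarrow> 'a set" where
  "center L = {z \<in> carrier L. \<forall>x \<in> carrier L. bracket L x z = 0 \<and> bracket L z x = 0}"

definition algebra_hom ::
    "'a::ab_group_add calgebra \<Rightarrow> 'b::ab_group_add calgebra \<Rightarrow> ('a \<Rightarrow> 'b) \<Rightarrow> bool" where
  "algebra_hom A B f \<longleftrightarrow>
     f ` carrier A \<subseteq> carrier B \<and>
     (\<forall>x \<in> carrier A. \<forall>y \<in> carrier A. f (x + y) = f x + f y) \<and>
     (\<forall>c. \<forall>x \<in> carrier A. f (smul A c x) = smul B c (f x)) \<and>
     (\<forall>x \<in> carrier A. \<forall>y \<in> carrier A. f (bracket A x y) = bracket B (f x) (f y))"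

definition isomorphic :: "'a::ab_group_add calgebra \<Rightarrow> 'b::ab_group_add calgebra \<Rightarrow> bool" where
  "isomorphic A B \<longleftrightarrow> (\<exists>f. algebra_hom A B f \<and> bij_betw f (carrier A) (carrier B))"

definition direct_sum ::
    "'a::ab_group_add calgebra \<Rightarrow> 'b::ab_group_add calgebra \<Rightarrow> ('a \<times> 'b) calgebra" where
  "direct_sum A B = \<lparr>
     carrier = carrier A \<times> carrier B,
     smul = (\<lambda>c (x, u). (smul A c x, smul B c u)),
     bracket = (\<lambda>(x, u) (y, v). (bracket A x y, bracket B u v))\<rparr>"

definition abelian_line :: "complex calgebra" where
  "abelian_line = \<lparr>carrier = UNIV, smul = (*), bracket = (\<lambda>_ _. 0)\<rparr>"

text \<open>
  \<open>E\<close> is a \<open>k\<close>-dimensional central extension of \<open>L\<close> via the short exact sequence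
  \<open>0 \<rightarrow> V \<rightarrow> E \<rightarrow> L \<rightarrow> 0\<close> with maps \<open>i\<close> and \<open>p\<close>.
\<close>

definition central_extension ::
    "nat \<Rightarrow> 'v::ab_group_add calgebra \<Rightarrow> ('v \<Rightarrow> 'a) \<Rightarrow> 'a::ab_group_add calgebra \<Rightarrow>
     ('a \<Rightarrow> 'l) \<Rightarrow> 'l::ab_group_add calgebra \<Rightarrow> bool" where
  "central_extension k V i E p L \<longleftrightarrow>
     leibniz_algebra V \<and> leibniz_algebra E \<and> leibniz_algebra L \<and>
     algebra_hom V E i \<and> algebra_hom E L p \<and>
     inj_on i (carrier V) \<and>
     i ` carrier V = {x \<in> carrier E. p x = 0} \<and>
     p ` carrier E = carrier L \<and>
     dimension V = k \<and>
     i ` carrier V \<subseteq> center E"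

text \<open>
  The algebra \<open>L'\<close> and the kernel \<open>V'\<close> are sought inside \<open>nat \<Rightarrow> complex\<close> with an arbitrary
  complex vector space structure.  This is no restriction: every finite-dimensional complex
  algebra is isomorphic to one carried by such a subspace.
\<close>

definition split_extension ::
    "nat \<Rightarrow> 'a::ab_group_add calgebra \<Rightarrow> 'l::ab_group_add calgebra \<Rightarrow> bool" where
  "split_extension k E L \<longleftrightarrow>
     k \<ge> 1 \<and>
     (\<exists>(L' :: (nat \<Rightarrow> complex) calgebra) (V' :: (nat \<Rightarrow> complex) calgebra) i' p'.
        central_extension (k - 1) V' i' L' p' L \<and>
        isomorphic E (direct_sum L' abelian_line))"

definition basis_vec :: "nat \<Rightarrow> nat \<Rightarrow> complex" where
  "basis_vec i = (\<lambda>j. if j = i then 1 else 0)"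

text \<open>
  The algebra with basis \<open>basis_vec 1, \<dots>, basis_vec n\<close> and multiplication table \<open>t\<close>, where
  \<open>t i j\<close> is the product of the \<open>i\<close>-th and the \<open>j\<close>-th basis vector.
\<close>

definition table_algebra :: "nat \<Rightarrow> (nat \<Rightarrow> nat \<Rightarrow> nat \<Rightarrow> complex) \<Rightarrow> (nat \<Rightarrow> complex) calgebra" where
  "table_algebra n t = \<lparr>
     carrier = {x. \<forall>i. i \<notin> {1..n} \<longrightarrow> x i = 0},
     smul = (\<lambda>c x m. c * x m),
     bracket = (\<lambda>x y m. \<Sum>i = 1..n. \<Sum>j = 1..n. x i * y j * t i j m)\<rparr>"

definition F1 :: "nat \<Rightarrow> (nat \<Rightarrow> complex) calgebra" where
  "F1 n = table_algebra n (\<lambda>i j.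
     if i = 1 \<and> j = 1 then basis_vec 3
     else if 2 \<le> i \<and> i \<le> n - 1 \<and> j = 1 then basis_vec (i + 1)
     else 0)"

definition F2 :: "nat \<Rightarrow> (nat \<Rightarrow> complex) calgebra" where
  "F2 n = table_algebra n (\<lambda>i j.
     if i = 1 \<and> j = 1 then basis_vec 3
     else if 3 \<le> i \<and> i \<le> n - 1 \<and> j = 1 then basis_vec (i + 1)
     else 0)"

lemma fun_vs: "vector_space (\<lambda>(c::complex) (x::nat\<Rightarrow>complex) m. c * x m)"
  by unfold_locales (auto simp: fun_eq_iff algebra_simps)

lemma carrier_table: "carrier (table_algebra n t) = module.span (\<lambda>c x m. c * x m) (basis_vec ` {1..n})"
proof -
  interpret vector_space "\<lambda>(c::complex) (x::nat\<Rightarrow>complex) m. c * x m" by (rule fun_vs)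
  have sub: "subspace {x::nat\<Rightarrow>complex. \<forall>i. i \<notin> {1..n} \<longrightarrow> x i = 0}"
    by (auto simp: subspace_def)
  have s: "(\<Sum>j=1..n. (\<lambda>m. f j * basis_vec j m)) m = (\<Sum>j=1..n. f j * basis_vec j m)" for f and m :: nat
    by (induction n) auto
  have "x \<in> span (basis_vec ` {1..n})" if x: "\<forall>i. i \<notin> {1..n} \<longrightarrow> x i = 0" for x
  proof -
    have "x = (\<Sum>j=1..n. (\<lambda>m. x j * basis_vec j m))"
    proof
      fix m
      have "(\<Sum>j=1..n. x j * basis_vec j m) = (\<Sum>j=1..n. if m = j then x j else 0)"
        by (rule sum.cong) (auto simp: basis_vec_def)
      also have "\<dots> = x m" using x by (auto simp: sum.delta)
      finally show "x m = (\<Sum>j=1..n. (\<lambda>m. x j * basis_vec j m)) m" using s by simp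
    qed
    also have "\<dots> \<in> span (basis_vec ` {1..n})"
      by (intro span_sum span_scale span_base) auto
    finally show ?thesis .
  qed
  moreover have "span (basis_vec ` {1..n}) \<subseteq> {x. \<forall>i. i \<notin> {1..n} \<longrightarrow> x i = 0}"
    by (rule span_minimal[OF _ sub]) (auto simp: basis_vec_def)
  ultimately show ?thesis by (auto simp: table_algebra_def)
qed

lemma complex_algebra_table:
  assumes "\<And>i j m. i \<in> {1..n} \<Longrightarrow> j \<in> {1..n} \<Longrightarrow> m \<notin> {1..n} \<Longrightarrow> t i j m = 0"
  shows "complex_algebra (table_algebra n t)"
proof (rule complex_algebra.intro)
  show "vector_space (smul (table_algebra n t))" using fun_vs by (simp add: table_algebra_def)
  show "\<exists>B. finite B \<and> carrier (table_algebra n t) = module.span (smul (table_algebra n t)) B"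
    by (intro exI[of _ "basis_vec ` {1..n}"]) (simp add: carrier_table, simp add: table_algebra_def)
  show "bracket (table_algebra n t) x y \<in> carrier (table_algebra n t)" for x y
    using assms by (auto simp: table_algebra_def intro!: sum.neutral)
qed (auto simp: table_algebra_def fun_eq_iff algebra_simps sum.distrib sum_distrib_left)

lemma leibniz_table:
  assumes n: "n \<ge> 1" and t: "\<And>i j m. i \<in> {1..n} \<Longrightarrow> m \<notin> {2..n} \<Longrightarrow> t i j m = 0"
    and t1: "\<And>i j. j \<noteq> 1 \<Longrightarrow> t i j = 0"
  shows "leibniz_algebra (table_algebra n t)"
proof -
  interpret complex_algebra "table_algebra n t"
    by (rule complex_algebra_table) (use t in auto)
  have b: "bracket (table_algebra n t) x y m = y 1 * (\<Sum>i=1..n. x i * t i 1 m)" for x y m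
  proof -
    have "(\<Sum>j=1..n. x i * y j * t i j m) = y 1 * (x i * t i 1 m)" for i
    proof -
      have "(\<Sum>j=1..n. x i * y j * t i j m) = (\<Sum>j=1..n. if j = 1 then y 1 * (x i * t i 1 m) else 0)"
        by (rule sum.cong) (auto simp: t1)
      then show ?thesis using n by simp
    qed
    then show ?thesis by (simp add: table_algebra_def sum_distrib_left)
  qed
  have b1: "bracket (table_algebra n t) x y 1 = 0" for x y
    using t by (simp add: b)
  show ?thesis
  proof
    fix x y z
    show "bracket (table_algebra n t) x (bracket (table_algebra n t) y z) =
      bracket (table_algebra n t) (bracket (table_algebra n t) x y) z - bracket (table_algebra n t) (bracket (table_algebra n t) x z) y"
      unfolding fun_eq_iff fun_diff_def b[of x "bracket (table_algebra n t) y z"] b1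
      by (simp add: b sum_distrib_left algebra_simps)
  qed
qed

lemma leibniz_F1: "n \<ge> 3 \<Longrightarrow> leibniz_algebra (F1 n)"
  unfolding F1_def by (rule leibniz_table) (auto simp: basis_vec_def fun_eq_iff)
lemma leibniz_F2: "n \<ge> 3 \<Longrightarrow> leibniz_algebra (F2 n)"
  unfolding F2_def by (rule leibniz_table) (auto simp: basis_vec_def fun_eq_iff)

lemma table_product:
  assumes "i \<in> {1..n}" "j \<in> {1..n}"
  shows "bracket (table_algebra n t) (basis_vec i) (basis_vec j) = t i j"
proof
  fix m
  have "(\<Sum>b=1..n. basis_vec i a * basis_vec j b * t a b m) = (if i = a then t i j m else 0)" for a
  proof -
    have "(\<Sum>b=1..n. basis_vec i a * basis_vec j b * t a b m) = (\<Sum>b=1..n. if j = b then (if i = a then t i j m else 0) else 0)"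
      by (rule sum.cong) (auto simp: basis_vec_def)
    then show ?thesis using assms by simp
  qed
  then show "bracket (table_algebra n t) (basis_vec i) (basis_vec j) m = t i j m"
    using assms by (simp add: table_algebra_def)
qed
end

theory Submission
  imports Defs
begin

text \<open>
  Let \<open>E\<close> be a central extension of \<open>L\<close> with kernel \<open>K\<close>.  A vector \<open>v\<close> of \<open>K\<close> outside the
  square \<open>[E, E]\<close> splits off: a linear functional \<open>\<phi>\<close> with \<open>\<phi> v = 1\<close> that vanishes on \<open>[E, E]\<close> has
  as kernel a subalgebra \<open>S\<close>, and \<open>E = S \<oplus> \<complex>v\<close> as an algebra because \<open>v\<close> is central.  Subtracting
  multiples of \<open>v\<close> shows that \<open>S\<close> still maps onto \<open>L\<close>, now with kernel \<open>S \<inter> K\<close> of dimension one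
  less; this is \<open>split_if_kernel_not_in_square\<close>.

  It remains to see that a kernel of dimension at least five cannot lie in \<open>[E, E]\<close>
  (\<open>kernel_in_square_dim_le_4\<close>).  Let \<open>a\<close> and \<open>b\<close> lift \<open>e\<^sub>1\<close> and \<open>e\<^sub>2\<close>, and put
  \<open>z\<^sub>3 = [a, a]\<close>, \<open>z\<^sub>j\<^sub>+\<^sub>1 = [z\<^sub>j, a]\<close>, so that \<open>z\<^sub>j\<close> lifts \<open>e\<^sub>j\<close> for \<open>3 \<le> j \<le> n\<close> and \<open>z\<^sub>n\<^sub>+\<^sub>1\<close> lies in
  \<open>K\<close>.  Products in \<open>E\<close> depend only on classes modulo \<open>K\<close>, so those of \<open>a, b, z\<^sub>3, \<dots>, z\<^sub>n\<close> span
  \<open>[E, E]\<close>.  The Leibniz identity gives \<open>[x, [a, a]] = 0\<close>, and the elements annihilated by all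
  left factors form a right ideal, so \<open>[x, z\<^sub>j] = 0\<close> for all \<open>j \<ge> 3\<close>; since \<open>[a, b]\<close> is
  central, also \<open>[z\<^sub>j, b] = 0\<close>.  What is left are \<open>z\<^sub>3, \<dots>, z\<^sub>n\<close> and
  \<open>[b, a], [z\<^sub>n, a], [a, b], [b, b]\<close>.  Corrected by a multiple of \<open>z\<^sub>3\<close>, the last four lie in \<open>K\<close>,
  whereas the \<open>z\<^sub>j\<close> are independent modulo \<open>K\<close>.  Hence \<open>K \<inter> [E, E]\<close> is spanned by four vectors.
  The two families of algebras differ only in \<open>[e\<^sub>2, e\<^sub>1]\<close>, which is \<open>e\<^sub>3\<close> or \<open>0\<close>, and are
  treated together by writing it as \<open>\<epsilon> e\<^sub>3\<close>.
\<close>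

section \<open>Maps between finite-dimensional complex algebras\<close>

lemma (in vector_space) span_image_sum:
  assumes "finite A" "x \<in> span (f ` A)"
  shows "\<exists>c. x = (\<Sum>j\<in>A. scale (c j) (f j))"
  using assms
proof (induction A arbitrary: x)
  case (insert a A)
  obtain r where "x - scale r (f a) \<in> span (f ` A)"
    using insert.prems by (auto simp: span_insert)
  then obtain c where "x - scale r (f a) = (\<Sum>j\<in>A. scale (c j) (f j))"
    using insert.IH by metis
  then have "x = scale r (f a) + (\<Sum>j\<in>A. scale (c j) (f j))" by (simp add: algebra_simps)
  also have "\<dots> = (\<Sum>j\<in>insert a A. scale ((c(a := r)) j) (f j))"
    using insert.hyps by (auto intro!: sum.cong)
  finally show ?case by (rule exI[of _ "c(a := r)"])
qed simp

lemma (in complex_algebra) carrier_basis: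
  obtains B where "finite B" "\<not> module.dependent (smul L) B" "B \<subseteq> carrier L"
    "carrier L = module.span (smul L) B"
proof -
  interpret vector_space "smul L" by (rule ambient)
  obtain T where T: "finite T" "carrier L = span T" using finite_dim by blast
  obtain B where B: "B \<subseteq> carrier L" "independent B" "carrier L \<subseteq> span B"
    by (rule maximal_independent_subset)
  have "finite B" using independent_span_bound[OF T(1) B(2)] B(1) T(2) by simp
  moreover have "span B \<subseteq> carrier L" using B(1) T(2) span_minimal[OF _ subspace_span] by simp
  ultimately show thesis using that B by blast
qed

lemma (in complex_algebra) subspace_carrier: "module.subspace (smul L) (carrier L)"
proof -
  interpret vector_space "smul L" by (rule ambient)
  show ?thesis using finite_dim subspace_span by metis
qed

text \<open>
  A homomorphism of algebras is only constrained on the carrier.  Replacing it by a map that is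
  linear on the whole ambient space gives access to the theory of linear maps, whose statements
  about images, kernels and sums presuppose global linearity.
\<close>

lemma algebra_hom_linear:
  assumes A: "complex_algebra A" and B: "complex_algebra B" and f: "algebra_hom A B f"
  obtains g where "Vector_Spaces.linear (smul A) (smul B) g" "\<And>x. x \<in> carrier A \<Longrightarrow> g x = f x"
proof -
  interpret A: complex_algebra A by fact
  interpret B: complex_algebra B by fact
  interpret vA: vector_space "smul A" by (rule A.ambient)
  interpret vB: vector_space "smul B" by (rule B.ambient)
  interpret vector_space_pair "smul A" "smul B" ..
  have add: "f (x + y) = f x + f y" if "x \<in> carrier A" "y \<in> carrier A" for x y
    using f that by (auto simp: algebra_hom_def)
  have scale: "f (smul A c x) = smul B c (f x)" if "x \<in> carrier A" for c x
    using f that by (auto simp: algebra_hom_def)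
  obtain S where S: "vA.independent S" "S \<subseteq> carrier A" "carrier A = vA.span S"
    by (rule A.carrier_basis) blast
  obtain g where g: "Vector_Spaces.linear (smul A) (smul B) g" "\<And>x. x \<in> S \<Longrightarrow> g x = f x"
    using linear_independent_extend[OF S(1), of f] by blast
  interpret g: Vector_Spaces.linear "smul A" "smul B" g by (rule g(1))
  have z: "0 \<in> carrier A" using A.subspace_carrier by (rule vA.subspace_0)
  have f0: "f 0 = 0" using add[OF z z] by simp
  have "vA.subspace {x \<in> carrier A. g x = f x}"
    using A.subspace_carrier
    by (auto simp: vA.subspace_def f0 add scale g.zero g.add g.scale)
  then have "vA.span S \<subseteq> {x \<in> carrier A. g x = f x}"
    using S(2) g(2) by (intro vA.span_minimal) auto
  with that[OF g(1)] S(3) show thesis by blast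
qed

lemma dim_image_linear_inj:
  assumes "Vector_Spaces.linear s1 s2 f" and S: "module.subspace s1 S" and inj: "inj_on f S"
  shows "vector_space.dim s2 (f ` S) = vector_space.dim s1 S"
proof -
  interpret f: Vector_Spaces.linear s1 s2 f by fact
  obtain B where B: "B \<subseteq> S" "f.vs1.independent B" "S \<subseteq> f.vs1.span B" "card B = f.vs1.dim S"
    by (rule f.vs1.basis_exists)
  have sp: "f.vs1.span B = S" using B S f.vs1.span_minimal by blast
  show ?thesis
  proof (rule f.vs2.dim_unique)
    show "f ` B \<subseteq> f ` S" using B by blast
    show "f ` S \<subseteq> f.vs2.span (f ` B)" using sp f.span_image by simp
    show "f.vs2.independent (f ` B)"
      using f.independent_inj_on_image[OF B(2)] inj sp by simp
    show "card (f ` B) = f.vs1.dim S"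
      using B(1,4) inj card_image inj_on_subset by metis
  qed
qed

lemma dimension_image:
  assumes "complex_algebra A" "complex_algebra B" "algebra_hom A B f" "inj_on f (carrier A)"
  shows "vector_space.dim (smul B) (f ` carrier A) = dimension A"
proof -
  obtain g where g: "Vector_Spaces.linear (smul A) (smul B) g" "\<And>x. x \<in> carrier A \<Longrightarrow> g x = f x"
    using algebra_hom_linear[OF assms(1-3)] by blast
  have "inj_on g (carrier A)" using assms(4) g(2) inj_on_cong by blast
  moreover have "g ` carrier A = f ` carrier A" using g(2) by simp
  ultimately show ?thesis
    using dim_image_linear_inj[OF g(1) complex_algebra.subspace_carrier[OF assms(1)]]
    by (simp add: dimension_def)
qed

section \<open>Subalgebras and transport of structure\<close>

lemma leibniz_subalgebra:
  assumes A: "leibniz_algebra A" and S: "module.subspace (smul A) S" "S \<subseteq> carrier A"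
    and cl: "\<And>x y. x \<in> S \<Longrightarrow> y \<in> S \<Longrightarrow> bracket A x y \<in> S"
  shows "leibniz_algebra (A\<lparr>carrier := S\<rparr>)"
proof -
  interpret A: leibniz_algebra A by fact
  interpret vector_space "smul A" by (rule A.ambient)
  obtain T where T: "finite T" "carrier A = span T" using A.finite_dim by blast
  obtain B where B: "B \<subseteq> S" "independent B" "S \<subseteq> span B"
    by (rule maximal_independent_subset)
  have "finite B" using independent_span_bound[OF T(1) B(2)] B(1) T(2) S(2) by auto
  moreover have "S = span B" using B S(1) span_minimal by blast
  ultimately have fin: "\<exists>B. finite B \<and> S = span B" by blast
  have "x \<in> carrier A" if "x \<in> S" for x using S(2) that by blast
  then show ?thesis
    by unfold_locales
      (use fin cl in \<open>auto simp: A.add_left A.add_right A.smul_left A.smul_right A.leibniz scale_right_distrib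
        scale_left_distrib\<close>)
qed

text \<open>
  Structure is carried along \<open>g\<close>, with \<open>h\<close> a left inverse of \<open>g\<close> on the carrier; \<open>s\<close> is the
  scalar multiplication of the target space.
\<close>

definition transport_algebra ::
    "(complex \<Rightarrow> 'b \<Rightarrow> 'b) \<Rightarrow> ('a \<Rightarrow> 'b) \<Rightarrow> ('b \<Rightarrow> 'a) \<Rightarrow> 'a::ab_group_add calgebra \<Rightarrow> 'b calgebra" where
  "transport_algebra s g h A = \<lparr>carrier = g ` carrier A, smul = s,
     bracket = (\<lambda>x y. g (bracket A (h x) (h y)))\<rparr>"

lemma leibniz_transport:
  assumes A: "leibniz_algebra A"
    and g: "Vector_Spaces.linear (smul A) s g" and h: "Vector_Spaces.linear s (smul A) h"
    and hg: "\<And>x. x \<in> carrier A \<Longrightarrow> h (g x) = x"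
  shows "leibniz_algebra (transport_algebra s g h A)"
proof -
  interpret A: leibniz_algebra A by fact
  interpret g: Vector_Spaces.linear "smul A" s g by fact
  interpret h: Vector_Spaces.linear s "smul A" h by fact
  obtain T where T: "finite T" "carrier A = g.vs1.span T" using A.finite_dim by blast
  then have "\<exists>B. finite B \<and> g ` carrier A = g.vs2.span B"
    using g.span_image by (intro exI[of _ "g ` T"]) simp
  then show ?thesis
    using g.vs1.subspace_add[OF A.subspace_carrier] g.vs1.subspace_scale[OF A.subspace_carrier]
      g.vs2.vector_space_axioms
    by unfold_locales
      (auto simp: transport_algebra_def hg A.closed A.add_left A.add_right A.smul_left A.smul_right
        A.leibniz g.vs2.scale_right_distrib g.vs2.scale_left_distrib
        h.add h.scale simp flip: g.add g.scale g.diff)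
qed

text \<open>
  Coordinates with respect to a finite basis of the carrier.  They serve to replace an algebra
  over an arbitrary ambient space by a copy inside \<open>nat \<Rightarrow> complex\<close>, where the complement of a
  split summand is required to live.
\<close>

lemma (in complex_algebra) coordinate_embedding:
  obtains g h where
    "Vector_Spaces.linear (smul L) (\<lambda>(c::complex) (x::nat \<Rightarrow> complex) m. c * x m) g"
    "Vector_Spaces.linear (\<lambda>(c::complex) (x::nat \<Rightarrow> complex) m. c * x m) (smul L) h"
    "\<And>x. x \<in> carrier L \<Longrightarrow> h (g x) = x"
proof -
  let ?s = "\<lambda>(c::complex) (x::nat \<Rightarrow> complex) m. c * x m"
  interpret vL: vector_space "smul L" by (rule ambient)
  interpret C: vector_space ?s by (rule fun_vs)
  interpret vector_space_pair "smul L" ?s ..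
  obtain B where B: "finite B" "vL.independent B" "carrier L = vL.span B"
    by (rule carrier_basis) blast
  obtain d :: "'a \<Rightarrow> nat" where d: "inj_on d B"
    using finite_imp_inj_to_nat_seg[OF B(1)] by blast
  obtain g where g: "Vector_Spaces.linear (smul L) ?s g" "\<And>b. b \<in> B \<Longrightarrow> g b = basis_vec (d b)"
    using linear_independent_extend[OF B(2), of "\<lambda>b. basis_vec (d b)"] by blast
  interpret g: Vector_Spaces.linear "smul L" ?s g by (rule g(1))
  have "inj_on g (carrier L)"
    unfolding g.inj_on_iff_eq_0[OF subspace_carrier]
  proof (intro ballI impI)
    fix x assume "x \<in> carrier L" and gx: "g x = 0"
    then obtain u where u: "x = (\<Sum>b\<in>B. smul L (u b) b)"
      using B(3) vL.span_finite[OF B(1)] by auto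
    have "u a = 0" if a: "a \<in> B" for a
    proof -
      have "g x = (\<Sum>b\<in>B. ?s (u b) (basis_vec (d b)))"
        by (simp add: u g.sum g.scale g(2))
      moreover have "(\<Sum>b\<in>T. ?s (u b) (basis_vec (d b))) m = (\<Sum>b\<in>T. u b * basis_vec (d b) m)"
        for T m by (induction T rule: infinite_finite_induct) auto
      ultimately have "(\<Sum>b\<in>B. u b * basis_vec (d b) (d a)) = 0" using gx by (metis zero_fun_apply)
      moreover have "(\<Sum>b\<in>B. u b * basis_vec (d b) (d a)) = (\<Sum>b\<in>B. if b = a then u a else 0)"
        using d a by (intro sum.cong) (auto simp: basis_vec_def inj_on_def)
      ultimately show ?thesis using a B(1) by simp
    qed
    then show "x = 0" by (simp add: u)
  qed
  then obtain h where "Vector_Spaces.linear ?s (smul L) h" "\<And>x. x \<in> carrier L \<Longrightarrow> h (g x) = x"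
    using linear_exists_left_inverse_on[OF g(1) subspace_carrier] by blast
  with g(1) that show thesis by blast
qed

text \<open>
  A vector outside a subspace extends a basis of that subspace to an independent set, on which a
  linear functional can be prescribed.
\<close>

lemma hyperplane_functional:
  assumes "vector_space s" and v: "v \<notin> module.span s P"
  obtains \<phi> where "Vector_Spaces.linear s ((*) :: complex \<Rightarrow> complex \<Rightarrow> complex) \<phi>" "\<phi> v = 1"
    "\<And>x. x \<in> module.span s P \<Longrightarrow> \<phi> x = 0"
proof -
  interpret vector_space s by fact
  interpret C: vector_space "(*) :: complex \<Rightarrow> complex \<Rightarrow> complex"
    by unfold_locales (auto simp: algebra_simps)
  interpret vector_space_pair s "(*) :: complex \<Rightarrow> complex \<Rightarrow> complex" ..
  obtain B where B: "B \<subseteq> P" "independent B" "P \<subseteq> span B" by (rule maximal_independent_subset)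
  have sp: "span B = span P" using B by (metis span_mono span_span subset_antisym)
  have vB: "v \<notin> span B" using v sp by simp
  have "\<exists>\<phi>. Vector_Spaces.linear s (*) \<phi> \<and>
      (\<forall>x\<in>insert v B. \<phi> x = (if x = v then 1 else 0 :: complex))"
    by (rule linear_independent_extend[OF independent_insertI[OF vB B(2)]])
  then obtain \<phi> where \<phi>: "Vector_Spaces.linear s (*) \<phi>"
      "\<forall>x\<in>insert v B. \<phi> x = (if x = v then 1 else 0 :: complex)"
    by (elim exE conjE) (rule that)
  interpret \<phi>: Vector_Spaces.linear s "(*)" \<phi> by (rule \<phi>(1))
  have \<phi>v: "\<phi> v = 1" using \<phi>(2) by simp
  have "B \<subseteq> {x. \<phi> x = 0}"
  proof
    fix b assume b: "b \<in> B"
    then have "b \<noteq> v" using vB span_base by blast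
    with \<phi>(2) b show "b \<in> {x. \<phi> x = 0}" by simp
  qed
  then have "span B \<subseteq> {x. \<phi> x = 0}" by (rule span_minimal[OF _ \<phi>.subspace_kernel])
  then have "\<phi> x = 0" if "x \<in> span P" for x using that unfolding sp by blast
  then show thesis by (rule that[OF \<phi>(1) \<phi>v])
qed

section \<open>A central direction outside the square splits off\<close>

definition square :: "'a::ab_group_add calgebra \<Rightarrow> 'a set" where
  "square A = module.span (smul A) {bracket A x y | x y. x \<in> carrier A \<and> y \<in> carrier A}"

lemma central_extension_linear_projection:
  assumes "central_extension k V i E p L"
  obtains q where "Vector_Spaces.linear (smul E) (smul L) q" "central_extension k V i E q L"
proof -
  have "complex_algebra E" "complex_algebra L" "algebra_hom E L p"
    using assms by (auto simp: central_extension_def leibniz_algebra_def)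
  then obtain q where q: "Vector_Spaces.linear (smul E) (smul L) q" "\<And>x. x \<in> carrier E \<Longrightarrow> q x = p x"
    using algebra_hom_linear by blast
  interpret q: Vector_Spaces.linear "smul E" "smul L" q by (rule q(1))
  interpret E: complex_algebra E by fact
  have "algebra_hom E L q"
    using \<open>algebra_hom E L p\<close>
    by (auto simp: algebra_hom_def q.add q.scale q(2) E.closed image_subset_iff)
  moreover have "q ` carrier E = p ` carrier E" using q(2) by simp
  moreover have "{x \<in> carrier E. q x = 0} = {x \<in> carrier E. p x = 0}" using q(2) by auto
  ultimately have "central_extension k V i E q L"
    using assms unfolding central_extension_def by (elim conjE, intro conjI) simp_all
  with q(1) that show thesis by blast
qed

text \<open>
  The hyperplane cut out in \<open>E\<close> by a functional that vanishes on the square is an ideal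
  complementary to the line through a central vector \<open>v\<close>.
  Since \<open>v\<close> lies in the kernel, the hyperplane still maps onto \<open>L\<close>.
\<close>

theorem split_if_kernel_not_in_square:
  assumes ce: "central_extension k V i E p L" and not_sub: "\<not> i ` carrier V \<subseteq> square E"
    and k: "k \<ge> 1"
  shows "split_extension k E L"
proof -
  let ?s = "\<lambda>(c::complex) (x::nat \<Rightarrow> complex) m. c * x m"
  obtain q where q: "Vector_Spaces.linear (smul E) (smul L) q" "central_extension k V i E q L"
    using central_extension_linear_projection[OF ce] .
  interpret q: Vector_Spaces.linear "smul E" "smul L" q by (rule q(1))
  interpret E: leibniz_algebra E using q(2) by (simp add: central_extension_def)
  interpret L: leibniz_algebra L using q(2) by (simp add: central_extension_def)
  define K where "K = {x \<in> carrier E. q x = 0}"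
  have iV: "i ` carrier V = K" and K_center: "K \<subseteq> center E" and q_onto: "q ` carrier E = carrier L"
    and q_mult: "\<And>x y. x \<in> carrier E \<Longrightarrow> y \<in> carrier E \<Longrightarrow> q (bracket E x y) = bracket L (q x) (q y)"
    using q(2) by (auto simp: central_extension_def K_def algebra_hom_def)
  have dimK: "q.vs1.dim K = k"
    using q(2) dimension_image[of V E i] iV by (auto simp: central_extension_def leibniz_algebra_def)
  obtain v where v: "v \<in> K" "v \<notin> square E" using not_sub iV by blast
  obtain \<phi> where \<phi>: "Vector_Spaces.linear (smul E) (*) \<phi>" "\<phi> v = 1"
      and \<phi>_square: "\<And>x. x \<in> square E \<Longrightarrow> \<phi> x = 0"
    using hyperplane_functional[OF E.ambient v(2)[unfolded square_def]] unfolding square_def by blast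
  have \<phi>_mult: "\<phi> (bracket E x y) = 0" if "x \<in> carrier E" "y \<in> carrier E" for x y
    using that by (intro \<phi>_square) (auto simp: square_def intro: q.vs1.span_base)
  interpret \<phi>: Vector_Spaces.linear "smul E" "(*)" \<phi> by (rule \<phi>(1))
  note subE = E.subspace_carrier
  define S where "S = {x \<in> carrier E. \<phi> x = 0}"
  have S_sub: "q.vs1.subspace S" "S \<subseteq> carrier E"
    using q.vs1.subspace_inter[OF subE \<phi>.subspace_kernel] by (auto simp: S_def Int_def)
  have K_sub: "q.vs1.subspace K"
    using q.vs1.subspace_inter[OF subE q.subspace_kernel] by (simp add: K_def Int_def)
  have KE: "K \<subseteq> carrier E" by (auto simp: K_def)
  have SK: "q.vs1.subspace (S \<inter> K)" by (rule q.vs1.subspace_inter[OF S_sub(1) K_sub])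
  have vE: "v \<in> carrier E" using v KE by blast
  have S_closed: "bracket E x y \<in> S" if "x \<in> carrier E" "y \<in> carrier E" for x y
    using that \<phi>_mult E.closed by (simp add: S_def)
  have K_null: "bracket E x y = 0" "bracket E y x = 0" if "x \<in> K" "y \<in> carrier E" for x y
    using that K_center by (auto simp: center_def)
  have proj: "x - smul E (\<phi> x) v \<in> S" if "x \<in> carrier E" for x
    using that vE \<phi>(2) q.vs1.subspace_diff[OF subE] q.vs1.subspace_scale[OF subE]
    by (simp add: S_def \<phi>.diff \<phi>.scale)
  have q_proj: "q (x - smul E c v) = q x" for x c
    using v(1) by (simp add: q.diff q.scale K_def)
  have dimSK: "q.vs1.dim (S \<inter> K) = k - 1"
  proof -
    obtain B where B: "B \<subseteq> S \<inter> K" "q.vs1.independent B" "S \<inter> K \<subseteq> q.vs1.span B"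
        "card B = q.vs1.dim (S \<inter> K)"
      by (rule q.vs1.basis_exists)
    have spB: "q.vs1.span B \<subseteq> S" using B(1) S_sub q.vs1.span_minimal by blast
    have vB: "v \<notin> q.vs1.span B" using spB \<phi>(2) by (auto simp: S_def)
    obtain T where "finite T" "carrier E = q.vs1.span T" using E.finite_dim by blast
    then have finB: "finite B"
      using q.vs1.independent_span_bound[OF _ B(2)] B(1) S_sub(2) by blast
    have "q.vs1.dim K = card (insert v B)"
    proof (rule q.vs1.dim_unique)
      show "insert v B \<subseteq> K" using v B(1) by blast
      show "q.vs1.independent (insert v B)" by (rule q.vs1.independent_insertI[OF vB B(2)])
      show "K \<subseteq> q.vs1.span (insert v B)"
      proof
        fix x assume x: "x \<in> K"
        have "x - smul E (\<phi> x) v \<in> S \<inter> K"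
          using x KE proj v q.vs1.subspace_diff[OF K_sub] q.vs1.subspace_scale[OF K_sub] by auto
        then show "x \<in> q.vs1.span (insert v B)"
          using B(3) by (auto simp: q.vs1.span_insert)
      qed
    qed simp
    also have "\<dots> = card B + 1" using vB finB q.vs1.span_base by (subst card_insert_disjoint) auto
    finally show ?thesis using dimK B(4) by simp
  qed
  \<comment> \<open>The complement is \<open>S\<close>; it is moved into \<open>nat \<Rightarrow> complex\<close>, and its kernel is taken
    as a subalgebra of the copy, so that the inclusion is the identity.\<close>
  define E' where "E' = E\<lparr>carrier := S\<rparr>"
  interpret E': leibniz_algebra E'
    unfolding E'_def using S_sub S_closed by (intro leibniz_subalgebra[OF E.leibniz_algebra_axioms]) auto
  have [simp]: "carrier E' = S" "smul E' = smul E" "bracket E' = bracket E"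
    by (simp_all add: E'_def)
  obtain g h where g: "Vector_Spaces.linear (smul E) ?s g" and h: "Vector_Spaces.linear ?s (smul E) h"
      and hg: "\<And>x. x \<in> S \<Longrightarrow> h (g x) = x"
    using E'.coordinate_embedding by (metis \<open>carrier E' = S\<close> \<open>smul E' = smul E\<close>)
  interpret g: Vector_Spaces.linear "smul E" ?s g by (rule g)
  interpret h: Vector_Spaces.linear ?s "smul E" h by (rule h)
  define L' where "L' = transport_algebra ?s g h E'"
  interpret L': leibniz_algebra L'
    unfolding L'_def using E'.leibniz_algebra_axioms g h hg by (intro leibniz_transport) auto
  have [simp]: "carrier L' = g ` S" "smul L' = ?s" "bracket L' = (\<lambda>x y. g (bracket E (h x) (h y)))"
    by (simp_all add: L'_def transport_algebra_def)
  define V' where "V' = L'\<lparr>carrier := g ` (S \<inter> K)\<rparr>"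
  have V'_simps [simp]: "carrier V' = g ` (S \<inter> K)" "smul V' = ?s"
      "bracket V' = (\<lambda>x y. g (bracket E (h x) (h y)))"
    by (simp_all add: V'_def)
  have gSK: "g.vs2.subspace (g ` (S \<inter> K))" by (rule g.subspace_image[OF SK])
  have "leibniz_algebra V'"
    unfolding V'_def
    using gSK g.vs2.subspace_0[OF gSK] KE
    by (intro leibniz_subalgebra[OF L'.leibniz_algebra_axioms]) (auto simp: hg K_null g.zero)
  moreover have "dimension V' = k - 1"
    using dim_image_linear_inj[OF g SK] hg dimSK
    by (simp add: dimension_def inj_on_def) (metis IntD1)
  moreover have "algebra_hom L' L (q \<circ> h)"
    using S_sub(2) q_onto
    by (auto simp: algebra_hom_def hg S_closed subset_iff q_mult h.add h.scale q.add q.scale)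
  moreover have "(q \<circ> h) ` carrier L' = carrier L"
  proof -
    have "q x \<in> q ` S" if "x \<in> carrier E" for x
      using proj[OF that] q_proj by (metis imageI)
    then have "q ` carrier E \<subseteq> q ` S" by (rule image_subsetI)
    then have "q ` S = carrier L" using image_mono[OF S_sub(2), of q] q_onto by simp
    then show ?thesis by (simp add: image_image hg)
  qed
  moreover have "id ` carrier V' = {x \<in> carrier L'. (q \<circ> h) x = 0}"
    using S_sub(2) by (auto simp: hg K_def)
  moreover have "id ` carrier V' \<subseteq> center L'"
    using S_sub(2) by (auto simp: center_def hg K_null g.zero subset_iff)
  moreover have "algebra_hom V' L' id" by (auto simp: algebra_hom_def)
  ultimately have ext: "central_extension (k - 1) V' id L' (q \<circ> h) L"
    using L'.leibniz_algebra_axioms L.leibniz_algebra_axioms by (simp add: central_extension_def)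
  let ?f = "\<lambda>x. (g (x - smul E (\<phi> x) v), \<phi> x)"
  have "algebra_hom E (direct_sum L' abelian_line) ?f"
    unfolding algebra_hom_def
  proof (intro conjI ballI allI)
    show "?f ` carrier E \<subseteq> carrier (direct_sum L' abelian_line)"
      using proj by (auto simp: direct_sum_def abelian_line_def)
    fix x y assume xy: "x \<in> carrier E" "y \<in> carrier E"
    show "?f (x + y) = ?f x + ?f y"
      by (simp add: \<phi>.add q.vs1.scale_left_distrib add_diff_add flip: g.add)
    have sc: "smul E c v \<in> K" for c using v(1) q.vs1.subspace_scale[OF K_sub] by blast
    \<comment> \<open>Products are unchanged under a change of the factors by kernel elements, and they lie in
      \<open>S\<close>; so \<open>E\<close> multiplies like its component in \<open>S\<close>.\<close>
    have "bracket E x y = bracket E (x - smul E (\<phi> x) v) (y - smul E (\<phi> y) v)"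
    proof -
      have e: "bracket E x y = bracket E x' y'" if "x' \<in> carrier E" "y' \<in> carrier E"
          "x = x' + a" "y = y' + b" "a \<in> K" "b \<in> K" for x' y' a b
        using that KE K_null q.vs1.subspace_add[OF subE] by (auto simp: E.add_left E.add_right subset_iff)
      show ?thesis
        by (rule e[OF _ _ _ _ sc sc]) (use xy proj S_sub(2) in auto)
    qed
    then show "?f (bracket E x y) = bracket (direct_sum L' abelian_line) (?f x) (?f y)"
      using proj xy \<phi>_mult[OF xy] by (simp add: direct_sum_def abelian_line_def hg)
  qed (auto simp: direct_sum_def abelian_line_def \<phi>.scale q.vs1.scale_right_diff_distrib simp flip: g.scale)
  moreover have "bij_betw ?f (carrier E) (carrier (direct_sum L' abelian_line))"
  proof (rule bij_betw_byWitness[where f' = "\<lambda>(u, c). h u + smul E c v"])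
    show "(\<lambda>(u, c). h u + smul E c v) ` carrier (direct_sum L' abelian_line) \<subseteq> carrier E"
      using S_sub(2) vE q.vs1.subspace_add[OF subE] q.vs1.subspace_scale[OF subE]
      by (auto simp: direct_sum_def hg)
  qed (use proj in \<open>auto simp: direct_sum_def abelian_line_def hg \<phi>.add \<phi>.scale \<phi>(2) S_def\<close>)
  ultimately have "isomorphic E (direct_sum L' abelian_line)"
    unfolding isomorphic_def by blast
  with ext k show ?thesis unfolding split_extension_def by blast
qed

section \<open>The square meets the kernel in dimension at most four\<close>

text \<open>
  In any extension the Leibniz identity forces the products \<open>[x, z\<^sub>j]\<close> and \<open>[z\<^sub>j, b]\<close> of lifts to
  vanish for \<open>j \<ge> 3\<close>.  The four kernel vectors that may occur in the square
  come from \<open>[e\<^sub>2, e\<^sub>1] - \<epsilon> e\<^sub>3\<close>, \<open>[e\<^sub>n, e\<^sub>1]\<close>, \<open>[e\<^sub>1, e\<^sub>2]\<close> and \<open>[e\<^sub>2, e\<^sub>2]\<close>, all of which vanish in \<open>L\<close>.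
\<close>

theorem kernel_in_square_dim_le_4:
  fixes e :: "nat \<Rightarrow> 'l::ab_group_add"
  assumes ce: "central_extension k V i E p L" and n: "n \<ge> 3"
    and span_e: "carrier L = module.span (smul L) (e ` {1..n})"
    and indep: "\<And>c. (\<Sum>j = 3..n. smul L (c j) (e j)) = 0 \<Longrightarrow> \<forall>j\<in>{3..n}. c j = 0"
    and e11: "bracket L (e 1) (e 1) = e 3"
    and e21: "bracket L (e 2) (e 1) = smul L \<epsilon> (e 3)"
    and ej1: "\<And>j. 3 \<le> j \<Longrightarrow> j < n \<Longrightarrow> bracket L (e j) (e 1) = e (Suc j)"
    and en1: "bracket L (e n) (e 1) = 0"
    and e12: "bracket L (e 1) (e 2) = 0" and e22: "bracket L (e 2) (e 2) = 0"
    and sub: "i ` carrier V \<subseteq> square E"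
  shows "k \<le> 4"
proof -
  note One_nat_def [simp del]
  obtain q where q: "Vector_Spaces.linear (smul E) (smul L) q" "central_extension k V i E q L"
    using central_extension_linear_projection[OF ce] .
  interpret q: Vector_Spaces.linear "smul E" "smul L" q by (rule q(1))
  interpret E: leibniz_algebra E using q(2) by (simp add: central_extension_def)
  define K where "K = {x \<in> carrier E. q x = 0}"
  have iV: "i ` carrier V = K" and K_center: "K \<subseteq> center E" and q_onto: "q ` carrier E = carrier L"
    and q_mult: "\<And>x y. x \<in> carrier E \<Longrightarrow> y \<in> carrier E \<Longrightarrow> q (bracket E x y) = bracket L (q x) (q y)"
    using q(2) by (auto simp: central_extension_def K_def algebra_hom_def)
  have dimK: "q.vs1.dim K = k"
    using q(2) dimension_image[of V E i] iV by (auto simp: central_extension_def leibniz_algebra_def)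
  note subE = E.subspace_carrier
  have KE: "K \<subseteq> carrier E" by (auto simp: K_def)
  have K_null: "bracket E x y = 0" "bracket E y x = 0" if "x \<in> K" "y \<in> carrier E" for x y
    using that K_center by (auto simp: center_def)
  have zeroE: "0 \<in> carrier E" by (rule q.vs1.subspace_0[OF subE])
  have zeroK: "0 \<in> K" using zeroE by (simp add: K_def q.zero)
  have K_sub: "q.vs1.subspace K"
    using q.vs1.subspace_inter[OF subE q.subspace_kernel] by (simp add: K_def Int_def)
  have "e 1 \<in> q ` carrier E" "e 2 \<in> q ` carrier E"
    unfolding q_onto span_e using n by (auto intro!: q.vs2.span_base)
  then obtain a b where a: "a \<in> carrier E" "q a = e 1" and b: "b \<in> carrier E" "q b = e 2"
    by force
  \<comment> \<open>The exponent makes \<open>z 2 = a\<close>, so that the recursion \<open>z (Suc j) = [z j, a]\<close> starts at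
    \<open>j = 2\<close> and its indices agree with those of \<open>e\<close> from \<open>3\<close> on.\<close>
  define z where "z j = ((\<lambda>x. bracket E x a) ^^ (j - 2)) a" for j
  have z2: "z 2 = a" by (simp add: z_def)
  have z_Suc: "z (Suc j) = bracket E (z j) a" if "j \<ge> 2" for j
    using that by (auto simp: z_def le_iff_add)
  have z3: "z 3 = bracket E a a" using z_Suc[of 2] z2 by simp
  have zE: "z j \<in> carrier E" if "j \<ge> 2" for j
    using that by (induction j rule: dec_induct) (simp_all add: z2 a z_Suc E.closed)
  have qz: "q (z j) = e j" if "3 \<le> j" "j \<le> n" for j
    using that
    by (induction j rule: dec_induct) (simp_all add: z3 z_Suc a q_mult e11 zE ej1)
  have K_ab: "bracket E a b \<in> K" "bracket E b b \<in> K" "z (Suc n) \<in> K"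
    using n by (simp_all add: K_def E.closed a b q_mult e12 e22 z_Suc zE qz en1)
  define w where "w = bracket E b a - smul E \<epsilon> (z 3)"
  have wK: "w \<in> K"
    using zE[of 3] n by (simp add: K_def w_def E.closed a b q_mult q.diff q.scale qz e21
        q.vs1.subspace_diff[OF subE] q.vs1.subspace_scale[OF subE])
  define W where "W = {w, z (Suc n), bracket E a b, bracket E b b}"
  have WK: "W \<subseteq> K" using wK K_ab by (simp add: W_def)
  define P where "P = q.vs1.span (z ` {3..n} \<union> W)"
  have P_sub: "q.vs1.subspace P" and WP: "W \<subseteq> P" and zP: "\<And>j. 3 \<le> j \<Longrightarrow> j \<le> n \<Longrightarrow> z j \<in> P"
    by (auto simp: P_def intro: q.vs1.span_base)
  have P0: "0 \<in> P" by (rule q.vs1.subspace_0[OF P_sub])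
  have zaP: "bracket E (z j) a \<in> P" if "3 \<le> j" "j \<le> n" for j
    using that zP[of "Suc j"] WP by (cases "j = n") (auto simp: z_Suc[symmetric] W_def)

  \<comment> \<open>The elements that every left factor annihilates form a right ideal containing \<open>[a, a]\<close>.\<close>
  have right_null: "bracket E x (z j) = 0" if "3 \<le> j" "x \<in> carrier E" for j x
    using that
  proof (induction j arbitrary: x rule: dec_induct)
    case base
    then show ?case by (simp add: z3 E.leibniz a)
  next
    case (step j)
    have "bracket E x (z (Suc j)) = bracket E (bracket E x (z j)) a - bracket E (bracket E x a) (z j)"
      using step by (simp add: z_Suc E.leibniz zE a)
    also have "\<dots> = 0" using step K_null[OF zeroK] by (simp add: E.closed a)
    finally show ?case .
  qed

  \<comment> \<open>Right multiplications by \<open>a\<close> and \<open>b\<close> commute because \<open>[a, b]\<close> is central; hence every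
    \<open>[z j, b]\<close> is obtained from the central element \<open>[a, b]\<close> by multiplying with \<open>a\<close>.\<close>
  have zb: "bracket E (z j) b = 0" if "3 \<le> j" for j
  proof -
    have "bracket E (bracket E x a) b = bracket E (bracket E x b) a" if "x \<in> carrier E" for x
      using E.leibniz[OF that a(1) b(1)] K_null(2)[OF K_ab(1) that] by simp
    then have zSb: "bracket E (z (Suc j)) b = bracket E (bracket E (z j) b) a" if "j \<ge> 2" for j
      using that by (simp add: z_Suc zE)
    show ?thesis
      using that
    proof (induction j rule: dec_induct)
      case base
      show ?case using zSb[of 2] K_null(1)[OF K_ab(1) a(1)] by (simp add: z2)
    next
      case (step j)
      then show ?case using zSb[of j] K_null(1)[OF zeroK a(1)] by simp
    qed
  qed

  define G where "G = {a, b} \<union> z ` {3..n} \<union> K"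
  have GE: "G \<subseteq> carrier E" using a b zE KE by (auto simp: G_def)
  have span_G: "carrier E \<subseteq> q.vs1.span G"
  proof
    fix y assume y: "y \<in> carrier E"
    have "e j \<in> q ` G" if j: "j \<in> {1..n}" for j
    proof -
      consider "j = 1" | "j = 2" | "3 \<le> j" using j by force
      then show ?thesis
      proof cases
        case 3
        then have "e j = q (z j)" "z j \<in> G" using j qz by (auto simp: G_def)
        then show ?thesis by blast
      qed (use a b in \<open>force simp: G_def\<close>)+
    qed
    then have "q.vs2.span (e ` {1..n}) \<subseteq> q ` q.vs1.span G"
      unfolding q.span_image[symmetric] by (intro q.vs2.span_mono) blast
    then obtain u where u: "u \<in> q.vs1.span G" "q y = q u"
      using y q_onto span_e by blast
    have "u \<in> carrier E" using u(1) q.vs1.span_minimal[OF GE subE] by blast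
    then have "y - u \<in> K" using u y by (simp add: K_def q.diff q.vs1.subspace_diff[OF subE])
    then have "y - u \<in> q.vs1.span G" by (intro q.vs1.span_base) (simp add: G_def)
    from q.vs1.span_add[OF this u(1)] show "y \<in> q.vs1.span G" by simp
  qed
  have left: "bracket E x y \<in> P" if x: "x \<in> carrier E" and y: "y \<in> carrier E"
      and gen: "\<And>x. x \<in> G \<Longrightarrow> bracket E x y \<in> P" for x y
  proof -
    have "q.vs1.subspace {x \<in> carrier E. bracket E x y \<in> P}"
      using y K_null[OF zeroK] P0 subE P_sub
      by (auto simp: q.vs1.subspace_def E.add_left E.smul_left)
    from q.vs1.span_minimal[OF _ this, of G] show ?thesis using GE gen span_G x by auto
  qed
  have right: "bracket E x y \<in> P" if x: "x \<in> carrier E" and y: "y \<in> carrier E"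
      and gen: "\<And>y. y \<in> G \<Longrightarrow> bracket E x y \<in> P" for x y
  proof -
    have "q.vs1.subspace {y \<in> carrier E. bracket E x y \<in> P}"
      using x K_null[OF zeroK] P0 subE P_sub
      by (auto simp: q.vs1.subspace_def E.add_right E.smul_right)
    from q.vs1.span_minimal[OF _ this, of G] show ?thesis using GE gen span_G y by auto
  qed
  have ba: "bracket E b a \<in> P"
  proof -
    have "w + smul E \<epsilon> (z 3) \<in> P"
      using WP zP[of 3] n P_sub by (auto simp: q.vs1.subspace_def W_def)
    then show ?thesis by (simp add: w_def)
  qed
  have "bracket E x y \<in> P" if x: "x \<in> carrier E" and y: "y \<in> carrier E" for x y
  proof (rule right[OF x y])
    fix y assume "y \<in> G"
    then consider "y = a" | "y = b" | j where "3 \<le> j" "y = z j" | "y \<in> K"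
      unfolding G_def by fastforce
    then show "bracket E x y \<in> P"
    proof cases
      case 1
      show ?thesis unfolding 1
        by (rule left[OF x a(1)])
          (use ba zP[of 3] z3 n zaP K_null a P0 in \<open>auto simp: G_def\<close>)
    next
      case 2
      show ?thesis unfolding 2
        by (rule left[OF x b(1)]) (use zb K_null b P0 WP in \<open>auto simp: G_def W_def\<close>)
    qed (use right_null K_null x P0 in auto)
  qed
  then have "square E \<subseteq> P"
    unfolding square_def by (intro q.vs1.span_minimal P_sub) auto

  \<comment> \<open>A kernel element of the square has no component along the \<open>z j\<close>, since these map to
    the independent vectors \<open>e j\<close>.\<close>
  have "K \<subseteq> q.vs1.span W"
  proof
    fix d assume d: "d \<in> K"
    then have "d \<in> P" using \<open>square E \<subseteq> P\<close> sub iV by blast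
    then obtain u v where u: "u \<in> q.vs1.span (z ` {3..n})" and v: "v \<in> q.vs1.span W" and duv: "d = u + v"
      unfolding P_def q.vs1.span_Un by blast
    obtain c where c: "u = (\<Sum>j = 3..n. smul E (c j) (z j))"
      using q.vs1.span_image_sum[OF finite_atLeastAtMost u] by metis
    have "v \<in> K" using v q.vs1.span_minimal[OF WK K_sub] by blast
    then have "q u = 0" using d duv by (simp add: K_def q.add)
    then have "(\<Sum>j = 3..n. smul L (c j) (e j)) = 0"
      by (simp add: c q.sum q.scale qz)
    then have "\<forall>j\<in>{3..n}. c j = 0" by (rule indep)
    then have "u = 0" by (simp add: c)
    then show "d \<in> q.vs1.span W" using duv v by simp
  qed
  then have "q.vs1.dim K \<le> card W" by (rule q.vs1.dim_le_card) (simp add: W_def)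
  also have "card W \<le> 4"
    using card_length[of "[w, z (Suc n), bracket E a b, bracket E b b]"] by (simp add: W_def)
  finally show ?thesis using dimK by simp
qed

lemma split_of_table:
  fixes t :: "nat \<Rightarrow> nat \<Rightarrow> nat \<Rightarrow> complex"
  assumes ce: "central_extension k V i E p (table_algebra n t)" and n: "n \<ge> 3" and k: "k \<ge> 5"
    and t11: "t 1 1 = basis_vec 3" and t21: "t 2 1 = (\<lambda>m. \<epsilon> * basis_vec 3 m)"
    and tj1: "\<And>j. 3 \<le> j \<Longrightarrow> j < n \<Longrightarrow> t j 1 = basis_vec (Suc j)"
    and tn1: "t n 1 = 0" and t12: "t 1 2 = 0" and t22: "t 2 2 = 0"
  shows "split_extension k E (table_algebra n t)"
proof (rule split_if_kernel_not_in_square[OF ce])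
  have smul: "smul (table_algebra n t) = (\<lambda>c x m. c * x m)" by (simp add: table_algebra_def)
  have eval: "(\<Sum>j\<in>J. (\<lambda>m. c j * basis_vec j m)) l = (\<Sum>j\<in>J. c j * basis_vec j l)" for J c l
    by (induction J rule: infinite_finite_induct) auto
  show "\<not> i ` carrier V \<subseteq> square E"
  proof
    assume sub: "i ` carrier V \<subseteq> square E"
    have "k \<le> 4"
    proof (rule kernel_in_square_dim_le_4[OF ce n, where e = basis_vec and \<epsilon> = \<epsilon>, OF _ _ _ _ _ _ _ _ sub])
      show "carrier (table_algebra n t) = module.span (smul (table_algebra n t)) (basis_vec ` {1..n})"
        unfolding smul by (rule carrier_table)
      fix c :: "nat \<Rightarrow> complex"
      assume "(\<Sum>j = 3..n. smul (table_algebra n t) (c j) (basis_vec j)) = 0"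
      then have 0: "(\<Sum>j = 3..n. c j * basis_vec j l) = 0" for l
        unfolding smul using eval[of c "{3..n}" l] by simp
      show "\<forall>l\<in>{3..n}. c l = 0"
      proof
        fix l assume l: "l \<in> {3..n}"
        have "(\<Sum>j = 3..n. c j * basis_vec j l) = (\<Sum>j = 3..n. if j = l then c l else 0)"
          by (rule sum.cong) (auto simp: basis_vec_def)
        then show "c l = 0" using 0 l by simp
      qed
    qed (use n in \<open>simp_all add: table_product smul t11 t21 tj1 tn1 t12 t22 zero_fun_def del: One_nat_def\<close>)
    with k show False by simp
  qed
qed (use k in simp)

theorem theorem4p10:
  fixes n k :: nat
  assumes "n \<ge> 3" and "k \<ge> 5"
  shows "(\<forall>(V :: 'v::ab_group_add calgebra) i (E :: 'a::ab_group_add calgebra) p.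
            central_extension k V i E p (F1 n) \<longrightarrow> split_extension k E (F1 n)) \<and>
         (\<forall>(V :: 'v calgebra) i (E :: 'a calgebra) p.
            central_extension k V i E p (F2 n) \<longrightarrow> split_extension k E (F2 n))"
proof (intro conjI allI impI)
  fix V :: "'v calgebra" and i and E :: "'a calgebra" and p
  show "split_extension k E (F1 n)" if "central_extension k V i E p (F1 n)"
    unfolding F1_def
    by (rule split_of_table[where \<epsilon> = 1, OF that[unfolded F1_def] assms])
      (use assms in \<open>auto simp: zero_fun_def\<close>)
  show "split_extension k E (F2 n)" if "central_extension k V i E p (F2 n)"
    unfolding F2_def
    by (rule split_of_table[where \<epsilon> = 0, OF that[unfolded F2_def] assms])
      (use assms in \<open>auto simp: zero_fun_def\<close>)
qed

end
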